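(* Let $\alpha>0$ be the fixed parameter of the iMAML objective. There exists a convex function $f$ with Lipschitz gradient and Lipschitz Hessian such that the iMAML meta-objective $\varphi(x) := f(z(x))$ is nonconvex, where $z(x)=x-\alpha\nabla f(z(x))$.
   Context: Here $f:\mathbb{R}^d\to\mathbb{R}$. For convex differentiable $f$ and $\alpha>0$, the equation $z(x)=x-\alpha\nabla f(z(x))$ defines $z(x)$ implicitly as $z(x)=\operatorname{argmin}_{z\in\mathbb{R}^d}\{f(z)+\frac{1}{2\alpha}\|z-x\|^2\}$. A differentiable function $\varphi$ is convex if $\varphi(y)\ge\varphi(x)+\langle\nabla\varphi(x),y-x\rangle$ for all $x,y\in\mathbb{R}^d$; it is nonconvex if this property does not hold. *)

theory Defs
  imports "HOL-Analysis.Analysis"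
begin

definition grad :: "('a::real_inner \<Rightarrow> real) \<Rightarrow> 'a \<Rightarrow> 'a" where
  "grad f x = (THE D. GDERIV f x :> D)"

lemma grad_eqI:
  assumes "GDERIV f x :> D"
  shows "grad f x = D"
  unfolding grad_def
proof (rule the_equality)
  show "GDERIV f x :> D"
    by (fact assms)
next
  fix E
  assume "GDERIV f x :> E"
  then have "(\<lambda>h. h \<bullet> E) = (\<lambda>h. h \<bullet> D)"
    using assms unfolding gderiv_def by (rule has_derivative_unique)
  then show "E = D"
    by (metis vector_eq_ldot)
qed

lemma GDERIV_grad:
  fixes f :: "'a::euclidean_space \<Rightarrow> real"
  assumes "f differentiable (at x)"
  shows "GDERIV f x :> grad f x"
proof -
  obtain f' where f': "(f has_derivative f') (at x)"
    using assms by (auto simp: differentiable_def)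
  then have lin: "linear f'"
    by (simp add: has_derivative_linear)
  define D where "D = (\<Sum>b\<in>Basis. f' b *\<^sub>R b)"
  have "f' h = h \<bullet> D" for h
  proof -
    have "f' h = f' (\<Sum>b\<in>Basis. (h \<bullet> b) *\<^sub>R b)"
      by (simp add: euclidean_representation)
    also have "\<dots> = (\<Sum>b\<in>Basis. (h \<bullet> b) * f' b)"
      using lin by (simp add: linear_sum linear_scale)
    also have "\<dots> = h \<bullet> D"
      by (simp add: D_def inner_sum_right mult.commute)
    finally show ?thesis .
  qed
  then have "f' = (\<lambda>h. h \<bullet> D)"
    by auto
  with f' have "GDERIV f x :> D"
    by (simp add: gderiv_def)
  then show ?thesis
    using grad_eqI by metis
qed

text \<open>The Hessian is the derivative of the gradient, as a bounded linear operator, so that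
  Lipschitz continuity of the Hessian refers to the operator norm.\<close>

definition hessian :: "('a::real_inner \<Rightarrow> real) \<Rightarrow> 'a \<Rightarrow> 'a \<Rightarrow>\<^sub>L 'a" where
  "hessian f x = Blinfun (frechet_derivative (grad f) (at x))"

definition lipschitz_gradient :: "('a::real_inner \<Rightarrow> real) \<Rightarrow> bool" where
  "lipschitz_gradient f \<longleftrightarrow>
     (\<forall>x. f differentiable (at x)) \<and> (\<exists>L. L-lipschitz_on UNIV (grad f))"

definition lipschitz_hessian :: "('a::real_inner \<Rightarrow> real) \<Rightarrow> bool" where
  "lipschitz_hessian f \<longleftrightarrow>
     (\<forall>x. f differentiable (at x)) \<and> (\<forall>x. grad f differentiable (at x)) \<and>
     (\<exists>L. L-lipschitz_on UNIV (hessian f))"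

text \<open>Both notions are reserved for differentiable functions; in particular a function
  does not count as nonconvex merely because it fails to be differentiable.\<close>

definition convex_diff :: "('a::real_inner \<Rightarrow> real) \<Rightarrow> bool" where
  "convex_diff \<phi> \<longleftrightarrow>
     (\<forall>x. \<phi> differentiable (at x)) \<and> (\<forall>x y. \<phi> y \<ge> \<phi> x + grad \<phi> x \<bullet> (y - x))"

definition nonconvex_diff :: "('a::real_inner \<Rightarrow> real) \<Rightarrow> bool" where
  "nonconvex_diff \<phi> \<longleftrightarrow>
     (\<forall>x. \<phi> differentiable (at x)) \<and> \<not> (\<forall>x y. \<phi> y \<ge> \<phi> x + grad \<phi> x \<bullet> (y - x))"

definition imaml_inner :: "real \<Rightarrow> ('a::real_inner \<Rightarrow> real) \<Rightarrow> 'a \<Rightarrow> 'a" where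
  "imaml_inner \<alpha> f x = arg_min (\<lambda>z. f z + 1 / (2 * \<alpha>) * (norm (z - x))\<^sup>2) (\<lambda>_. True)"

definition imaml_objective :: "real \<Rightarrow> ('a::real_inner \<Rightarrow> real) \<Rightarrow> 'a \<Rightarrow> real" where
  "imaml_objective \<alpha> f x = f (imaml_inner \<alpha> f x)"

text \<open>For convex \<open>f\<close> and \<open>\<alpha> > 0\<close>, a solution of the implicit equation is the unique
  minimiser, so \<^const>\<open>arg_min\<close> involves no choice there.\<close>

lemma imaml_inner_eqI:
  assumes "convex_diff f" and "\<alpha> > 0" and w: "w = x - \<alpha> *\<^sub>R grad f w"
  shows "imaml_inner \<alpha> f x = w"
proof -
  define F where "F = (\<lambda>z. f z + 1 / (2 * \<alpha>) * (norm (z - x))\<^sup>2)"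
  have strict: "F w < F z" if "z \<noteq> w" for z
  proof -
    have "f z \<ge> f w + grad f w \<bullet> (z - w)"
      using assms(1) by (simp add: convex_diff_def)
    moreover have "(norm (z - x))\<^sup>2 = (norm (w - x))\<^sup>2 + 2 * ((w - x) \<bullet> (z - w)) + (norm (z - w))\<^sup>2"
      by (simp add: power2_norm_eq_inner inner_diff_left inner_diff_right inner_commute)
    moreover have "w - x = - (\<alpha> *\<^sub>R grad f w)"
      using w by (simp add: algebra_simps)
    then have "(w - x) \<bullet> (z - w) = - (\<alpha> * (grad f w \<bullet> (z - w)))"
      by (metis inner_minus_left inner_scaleR_left)
    ultimately have le: "f z \<ge> f w + grad f w \<bullet> (z - w)"
      and eq: "(norm (z - x))\<^sup>2
        = (norm (w - x))\<^sup>2 - 2 * \<alpha> * (grad f w \<bullet> (z - w)) + (norm (z - w))\<^sup>2"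
      by simp_all
    have "1 / (2 * \<alpha>) * (norm (z - x))\<^sup>2 = 1 / (2 * \<alpha>) * (norm (w - x))\<^sup>2
        - grad f w \<bullet> (z - w) + 1 / (2 * \<alpha>) * (norm (z - w))\<^sup>2"
      unfolding eq using \<open>\<alpha> > 0\<close> by (simp add: field_simps)
    then have "F z \<ge> F w + 1 / (2 * \<alpha>) * (norm (z - w))\<^sup>2"
      using le unfolding F_def by linarith
    moreover have "1 / (2 * \<alpha>) * (norm (z - w))\<^sup>2 > 0"
      using that \<open>\<alpha> > 0\<close> by simp
    ultimately show ?thesis
      by linarith
  qed
  have "is_arg_min F (\<lambda>_. True) = (\<lambda>z. z = w)"
    using strict unfolding is_arg_min_def by (metis less_asym)
  then have "arg_min F (\<lambda>_. True) = w"
    by (simp add: arg_min_def)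
  then show ?thesis
    by (simp add: imaml_inner_def F_def)
qed

end

theory Submission
  imports Defs
begin

text \<open>
  The gradient of a convex function is monotone, but the proximal map \<open>x \<mapsto> z(x)\<close> moves faster
  where the curvature is small and slower where it is large. In one variable,
  \<open>\<phi>'(x) = g'(z) / (1 + \<alpha> g''(z))\<close> with \<open>z = z(x)\<close>, so \<open>\<phi>'\<close> decreases wherever \<open>g'\<close> is
  positive and \<open>1 + \<alpha> g''\<close> grows at a greater relative rate than \<open>g'\<close>. An oscillating curvature
  on top of a linearly growing derivative does this: take \<open>g(t) = (t\<^sup>2/2 - cos t) / \<alpha>\<close>, for which \<open>\<alpha> g'(t) = t + sin t\<close> and
  \<open>\<alpha> g''(t) = 1 + cos t\<close> lies between \<open>0\<close> and \<open>2\<close>. The curvature vanishes at \<open>t = \<pi>\<close> and is maximal at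
  \<open>t = 2\<pi>\<close>; these points are the proximal images of \<open>2\<pi>\<close> and \<open>4\<pi>\<close>, and the tangent to \<open>\<phi>\<close> at
  \<open>2\<pi>\<close> passes above the graph at \<open>4\<pi>\<close>.

  In \<open>\<real>\<^sup>n\<close> the same function is used in the direction of a unit vector \<open>e\<close>, as \<open>f(x) = g(x \<bullet> e)\<close>.
  The gradient of such a ridge function is a multiple of \<open>e\<close>, so the implicit equation for \<open>z(x)\<close>
  only shifts \<open>x\<close> along \<open>e\<close> and becomes the scalar equation \<open>t + \<alpha> g'(t) = x \<bullet> e\<close>
  (\<open>imaml_inner_ridge\<close>); everything else reduces to calculus in one variable.
\<close>

section \<open>Ridge functions\<close>

lemma GDERIV_ridge:
  assumes "(g has_real_derivative d) (at (x \<bullet> e))"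
  shows "GDERIV (\<lambda>x. g (x \<bullet> e)) x :> d *\<^sub>R e"
proof -
  have "GDERIV (\<lambda>x. x \<bullet> e) x :> e"
    unfolding gderiv_def by (auto intro!: derivative_eq_intros)
  then show ?thesis
    using assms by (rule GDERIV_DERIV_compose)
qed

lemma grad_ridge:
  assumes "\<And>t. (g has_real_derivative p t) (at t)"
  shows "grad (\<lambda>x. g (x \<bullet> e)) = (\<lambda>x. p (x \<bullet> e) *\<^sub>R e)"
  by (rule ext, rule grad_eqI, rule GDERIV_ridge, rule assms)

lemma differentiable_ridge:
  assumes "\<And>t. (g has_real_derivative p t) (at t)"
  shows "(\<lambda>x. g (x \<bullet> e)) differentiable (at x)"
  using GDERIV_ridge[OF assms] unfolding gderiv_def differentiable_def by blast

lemma convex_diff_ridge: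
  assumes g: "\<And>t. (g has_real_derivative p t) (at t)"
    and p: "\<And>t. (p has_real_derivative p' t) (at t)"
    and nonneg: "\<And>t. p' t \<ge> 0"
  shows "convex_diff (\<lambda>x. g (x \<bullet> e))"
proof -
  have "convex_on UNIV g"
    by (rule f''_ge0_imp_convex) (use assms in auto)
  then have "g s - g t \<ge> p t * (s - t)" for s t
    by (rule convex_on_imp_above_tangent) (use g in auto)
  then have "g s \<ge> g t + p t * (s - t)" for s t
    by (smt (verit))
  then show ?thesis
    by (simp add: convex_diff_def differentiable_ridge[OF g] grad_ridge[OF g]
        inner_diff_right inner_commute[of e] right_diff_distrib)
qed

lemma lipschitz_on_UNIV_of_bounded_derivative:
  fixes p p' :: "real \<Rightarrow> real"
  assumes "\<And>t. (p has_real_derivative p' t) (at t)" and "\<And>t. \<bar>p' t\<bar> \<le> L"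
  shows "L-lipschitz_on UNIV p"
proof (rule lipschitz_onI)
  show "dist (p s) (p t) \<le> L * dist s t" for s t
    unfolding dist_norm by (rule field_differentiable_bound[of UNIV p p']) (use assms in auto)
  show "0 \<le> L"
    using assms(2)[of 0] by linarith
qed

lemma dist_inner_unit_le_dist:
  assumes "norm e = 1"
  shows "dist (x \<bullet> e) (y \<bullet> e) \<le> dist x y"
  using Cauchy_Schwarz_ineq2[of "x - y" e] assms by (simp add: dist_norm inner_diff_left)

lemma lipschitz_gradient_ridge:
  assumes g: "\<And>t. (g has_real_derivative p t) (at t)"
    and lip: "L-lipschitz_on UNIV p" and e: "norm e = 1"
  shows "lipschitz_gradient (\<lambda>x. g (x \<bullet> e))"
proof -
  have "L-lipschitz_on UNIV (\<lambda>x. p (x \<bullet> e) *\<^sub>R e)"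
  proof (rule lipschitz_onI)
    fix x y
    have "dist (p (x \<bullet> e) *\<^sub>R e) (p (y \<bullet> e) *\<^sub>R e) = dist (p (x \<bullet> e)) (p (y \<bullet> e))"
      using e by (simp add: dist_norm flip: scaleR_diff_left)
    also have "\<dots> \<le> L * dist (x \<bullet> e) (y \<bullet> e)"
      using lip by (auto dest: lipschitz_onD)
    also have "\<dots> \<le> L * dist x y"
      by (intro mult_left_mono dist_inner_unit_le_dist e lipschitz_on_nonneg[OF lip])
    finally show "dist (p (x \<bullet> e) *\<^sub>R e) (p (y \<bullet> e) *\<^sub>R e) \<le> L * dist x y" .
  qed (rule lipschitz_on_nonneg[OF lip])
  then show ?thesis
    using differentiable_ridge[OF g] by (auto simp: lipschitz_gradient_def grad_ridge[OF g])
qed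

text \<open>The Hessian at every point is a multiple of one fixed operator, the orthogonal projection
  onto the line of \<open>e\<close>, so its dependence on the point is that of the scalar factor \<open>p'\<close>.\<close>

lemma has_derivative_grad_ridge:
  assumes g: "\<And>t. (g has_real_derivative p t) (at t)"
    and p: "\<And>t. (p has_real_derivative p' t) (at t)"
  shows "(grad (\<lambda>x. g (x \<bullet> e)) has_derivative (\<lambda>h. p' (x \<bullet> e) *\<^sub>R (h \<bullet> e) *\<^sub>R e)) (at x)"
proof -
  have "((\<lambda>x. p (x \<bullet> e)) has_derivative (\<lambda>h. p' (x \<bullet> e) * (h \<bullet> e))) (at x)"
    using GDERIV_ridge[OF p, where x = x and e = e] by (simp add: gderiv_def)
  from has_derivative_scaleR_left[OF this, of e] show ?thesis
    by (simp add: grad_ridge[OF g])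
qed

lemma hessian_ridge:
  assumes g: "\<And>t. (g has_real_derivative p t) (at t)"
    and p: "\<And>t. (p has_real_derivative p' t) (at t)"
  shows "hessian (\<lambda>x. g (x \<bullet> e)) x = p' (x \<bullet> e) *\<^sub>R Blinfun (\<lambda>h. (h \<bullet> e) *\<^sub>R e)"
proof -
  have E: "bounded_linear (\<lambda>h. (h \<bullet> e) *\<^sub>R e)"
    by (intro bounded_linear_intros)
  have d: "frechet_derivative (grad (\<lambda>x. g (x \<bullet> e))) (at x) = (\<lambda>h. p' (x \<bullet> e) *\<^sub>R (h \<bullet> e) *\<^sub>R e)"
    using frechet_derivative_at[OF has_derivative_grad_ridge[OF g p]] by metis
  show ?thesis
    unfolding hessian_def d
    by (rule blinfun_eqI)
       (simp add: bounded_linear_Blinfun_apply bounded_linear_scaleR_right bounded_linear_const_scaleR E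
          blinfun.scaleR_left del: scaleR_scaleR)
qed

lemma lipschitz_hessian_ridge:
  assumes g: "\<And>t. (g has_real_derivative p t) (at t)"
    and p: "\<And>t. (p has_real_derivative p' t) (at t)"
    and lip: "L-lipschitz_on UNIV p'" and e: "norm e = 1"
  shows "lipschitz_hessian (\<lambda>x. g (x \<bullet> e))"
proof -
  define E where "E = Blinfun (\<lambda>h. (h \<bullet> e) *\<^sub>R e)"
  have "bounded_linear (\<lambda>h. (h \<bullet> e) *\<^sub>R e)"
    by (intro bounded_linear_intros)
  then have E: "norm E \<le> 1"
    unfolding E_def using Cauchy_Schwarz_ineq2[of _ e] e
    by (intro norm_blinfun_bound) (auto simp: bounded_linear_Blinfun_apply)
  have "L-lipschitz_on UNIV (\<lambda>x. p' (x \<bullet> e) *\<^sub>R E)"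
  proof (rule lipschitz_onI)
    fix x y
    have "dist (p' (x \<bullet> e) *\<^sub>R E) (p' (y \<bullet> e) *\<^sub>R E) = dist (p' (x \<bullet> e)) (p' (y \<bullet> e)) * norm E"
      by (simp add: dist_norm flip: scaleR_diff_left)
    also have "\<dots> \<le> dist (p' (x \<bullet> e)) (p' (y \<bullet> e))"
      using E by (intro mult_left_le) auto
    also have "\<dots> \<le> L * dist (x \<bullet> e) (y \<bullet> e)"
      using lip by (auto dest: lipschitz_onD)
    also have "\<dots> \<le> L * dist x y"
      by (intro mult_left_mono dist_inner_unit_le_dist e lipschitz_on_nonneg[OF lip])
    finally show "dist (p' (x \<bullet> e) *\<^sub>R E) (p' (y \<bullet> e) *\<^sub>R E) \<le> L * dist x y" .
  qed (rule lipschitz_on_nonneg[OF lip])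
  then show ?thesis
    using differentiable_ridge[OF g] has_derivative_grad_ridge[OF g p, of e]
    unfolding lipschitz_hessian_def hessian_ridge[OF g p] E_def differentiable_def by blast
qed

section \<open>The meta-objective of a ridge function\<close>

lemma bij_of_derivative_ge_1:
  fixes S S' :: "real \<Rightarrow> real"
  assumes S: "\<And>t. (S has_real_derivative S' t) (at t)" and ge: "\<And>t. S' t \<ge> 1"
  shows "bij S"
proof -
  have expand: "S b - S a \<ge> b - a" if ab: "a < b" for a b
  proof -
    obtain c where "S b - S a = (b - a) * S' c"
      using MVT2[OF ab, of S S'] S by auto
    then show ?thesis
      using ge[of c] ab by (simp add: mult_le_cancel_left1)
  qed
  have cont: "isCont S t" for t
    using S by (rule DERIV_isCont)
  have "\<exists>t. S t = y" for y
  proof -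
    \<comment> \<open>Since \<open>S\<close> moves by at least \<open>r\<close> in each direction, it passes \<open>y\<close> within distance \<open>r\<close> of \<open>0\<close>.\<close>
    define r where "r = \<bar>y - S 0\<bar> + 1"
    then have "r > 0" and "\<bar>y - S 0\<bar> \<le> r"
      by auto
    then have "S (- r) \<le> y" "y \<le> S r" "- r \<le> r"
      using expand[of "- r" 0] expand[of 0 r] by auto
    then show ?thesis
      using IVT[of S "- r" y r] cont by auto
  qed
  moreover have "inj S"
    by (rule linorder_injI) (use expand in fastforce)
  ultimately show ?thesis
    by (metis bij_def surjI surj_def)
qed

text \<open>The gradient is a multiple of \<open>e\<close>, so \<open>x\<close> and its proximal point differ only along \<open>e\<close>, and a
  solution of the scalar equation for the \<open>e\<close>-component determines the whole point.\<close>

lemma imaml_inner_ridge: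
  assumes g: "\<And>t. (g has_real_derivative p t) (at t)"
    and "convex_diff (\<lambda>x. g (x \<bullet> e))" and "\<alpha> > 0" and e: "norm e = 1"
    and t: "t + \<alpha> * p t = x \<bullet> e"
  shows "imaml_inner \<alpha> (\<lambda>x. g (x \<bullet> e)) x = x - (\<alpha> * p t) *\<^sub>R e"
    and "imaml_inner \<alpha> (\<lambda>x. g (x \<bullet> e)) x \<bullet> e = t"
proof -
  have "e \<bullet> e = 1"
    using e by (simp add: norm_eq_1)
  then have eq: "(x - (\<alpha> * p t) *\<^sub>R e) \<bullet> e = t"
    using t by (simp add: inner_diff_left)
  show inner: "imaml_inner \<alpha> (\<lambda>x. g (x \<bullet> e)) x = x - (\<alpha> * p t) *\<^sub>R e"
    by (rule imaml_inner_eqI) (use assms eq in \<open>auto simp: grad_ridge[OF g]\<close>)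
  show "imaml_inner \<alpha> (\<lambda>x. g (x \<bullet> e)) x \<bullet> e = t"
    unfolding inner by (rule eq)
qed

text \<open>The proximal point has \<open>e\<close>-component \<open>Z(x \<bullet> e)\<close>, where \<open>Z\<close> inverts \<open>t \<mapsto> t + \<alpha> p(t)\<close>. Thus the
  meta-objective is again a ridge function, and the inverse function theorem gives its slope.\<close>

lemma imaml_objective_ridge:
  assumes g: "\<And>t. (g has_real_derivative p t) (at t)"
    and p: "\<And>t. (p has_real_derivative p' t) (at t)"
    and nonneg: "\<And>t. p' t \<ge> 0" and \<alpha>: "\<alpha> > 0" and e: "norm e = 1"
  obtains Z :: "real \<Rightarrow> real" where
    "\<And>t. Z (t + \<alpha> * p t) = t"
    and "imaml_objective \<alpha> (\<lambda>x. g (x \<bullet> e)) = (\<lambda>x. g (Z (x \<bullet> e)))"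
    and "\<And>x. imaml_inner \<alpha> (\<lambda>x. g (x \<bullet> e)) x =
           x - \<alpha> *\<^sub>R grad (\<lambda>x. g (x \<bullet> e)) (imaml_inner \<alpha> (\<lambda>x. g (x \<bullet> e)) x)"
    and "\<And>s. ((\<lambda>s. g (Z s)) has_real_derivative p (Z s) / (1 + \<alpha> * p' (Z s))) (at s)"
proof
  define S where "S = (\<lambda>t. t + \<alpha> * p t)"
  define Z where "Z = inv S"
  have S: "(S has_real_derivative 1 + \<alpha> * p' t) (at t)" for t
    unfolding S_def by (auto intro!: derivative_eq_intros p)
  have pos: "1 + \<alpha> * p' t \<ge> 1" for t
    using nonneg \<alpha> by simp
  have bij: "bij S"
    using S pos by (rule bij_of_derivative_ge_1)
  then have ZS: "Z (S t) = t" and SZ: "S (Z s) = s" for s t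
    by (simp_all add: Z_def bij_is_inj bij_is_surj surj_f_inv_f)
  show "inv S (t + \<alpha> * p t) = t" for t
    using ZS by (simp add: S_def Z_def)
  have conv: "convex_diff (\<lambda>x. g (x \<bullet> e))"
    using g p nonneg by (rule convex_diff_ridge)
  have eq: "Z s + \<alpha> * p (Z s) = s" for s
    using SZ by (simp add: S_def)
  note inner = imaml_inner_ridge[OF g conv \<alpha> e eq]
  show "imaml_objective \<alpha> (\<lambda>x. g (x \<bullet> e)) = (\<lambda>x. g (inv S (x \<bullet> e)))"
    by (rule ext) (simp add: imaml_objective_def inner(2) flip: Z_def)
  show "imaml_inner \<alpha> (\<lambda>x. g (x \<bullet> e)) x =
      x - \<alpha> *\<^sub>R grad (\<lambda>x. g (x \<bullet> e)) (imaml_inner \<alpha> (\<lambda>x. g (x \<bullet> e)) x)" for x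
    by (simp add: grad_ridge[OF g] inner(2)) (simp add: inner(1))
  show "((\<lambda>s. g (inv S s)) has_real_derivative p (inv S s) / (1 + \<alpha> * p' (inv S s))) (at s)" for s
  proof -
    have "isCont Z (S (Z s))"
      by (rule isCont_inverse_function[of 1]) (use ZS DERIV_isCont[OF S] in auto)
    then have "(Z has_real_derivative inverse (1 + \<alpha> * p' (Z s))) (at s)"
      using S[of "Z s"] pos[of "Z s"] SZ
      by (intro DERIV_inverse_function[of S _ Z s "s - 1" "s + 1"]) auto
    from DERIV_chain2[OF g this] show ?thesis
      by (simp add: Z_def field_simps)
  qed
qed

section \<open>A ridge function with nonconvex meta-objective\<close>

theorem theorem1:
  fixes \<alpha> :: real
  assumes "\<alpha> > 0"
  shows "\<exists>f :: real ^ 'n \<Rightarrow> real.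
    convex_diff f \<and> lipschitz_gradient f \<and> lipschitz_hessian f \<and>
    (\<forall>x. imaml_inner \<alpha> f x = x - \<alpha> *\<^sub>R grad f (imaml_inner \<alpha> f x)) \<and>
    nonconvex_diff (imaml_objective \<alpha> f)"
proof -
  obtain e :: "real ^ 'n" where e: "norm e = 1"
    using vector_choose_size[of 1] by auto
  define g :: "real \<Rightarrow> real" where "g = (\<lambda>t. (t\<^sup>2 / 2 - cos t) / \<alpha>)"
  define p :: "real \<Rightarrow> real" where "p = (\<lambda>t. (t + sin t) / \<alpha>)"
  define p' :: "real \<Rightarrow> real" where "p' = (\<lambda>t. (1 + cos t) / \<alpha>)"
  define f :: "real ^ 'n \<Rightarrow> real" where "f = (\<lambda>x. g (x \<bullet> e))"
  have g: "(g has_real_derivative p t) (at t)" for t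
    unfolding g_def p_def using assms by (auto intro!: derivative_eq_intros simp: field_simps)
  have p: "(p has_real_derivative p' t) (at t)" for t
    unfolding p_def p'_def using assms by (auto intro!: derivative_eq_intros simp: field_simps)
  have p': "(p' has_real_derivative - sin t / \<alpha>) (at t)" for t
    unfolding p'_def using assms by (auto intro!: derivative_eq_intros simp: field_simps)
  have "1 + cos t \<ge> 0" for t :: real
    using cos_ge_minus_one[of t] by linarith
  then have nonneg: "p' t \<ge> 0" for t
    using assms by (simp add: p'_def)
  have "p' t \<le> 2 / \<alpha>" for t
    using cos_le_one[of t] assms by (simp add: p'_def divide_right_mono)
  then have lip_p: "(2 / \<alpha>)-lipschitz_on UNIV p"
    using p nonneg by (intro lipschitz_on_UNIV_of_bounded_derivative) auto
  have "\<bar>- sin t / \<alpha>\<bar> \<le> 1 / \<alpha>" for t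
    using abs_sin_le_one[of t] assms by (simp add: divide_right_mono)
  with p' have lip_p': "(1 / \<alpha>)-lipschitz_on UNIV p'"
    by (rule lipschitz_on_UNIV_of_bounded_derivative)
  obtain Z where Z: "\<And>t. Z (t + \<alpha> * p t) = t"
    and obj: "imaml_objective \<alpha> f = (\<lambda>x. g (Z (x \<bullet> e)))"
    and inner: "\<And>x. imaml_inner \<alpha> f x = x - \<alpha> *\<^sub>R grad f (imaml_inner \<alpha> f x)"
    and deriv: "\<And>s. ((\<lambda>s. g (Z s)) has_real_derivative p (Z s) / (1 + \<alpha> * p' (Z s))) (at s)"
    by (rule imaml_objective_ridge[OF g p nonneg assms e, folded f_def]) (rule that)
  have "Z (2 * pi) = pi" "Z (4 * pi) = 2 * pi"
    using Z[of pi] Z[of "2 * pi"] assms by (simp_all add: p_def)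
  \<comment> \<open>Multiplied by \<open>\<alpha>\<close>, this reads \<open>2 \<pi>\<^sup>2 - 1 < (\<pi>\<^sup>2/2 + 1) + \<pi> * 2 \<pi>\<close>.\<close>
  then have violated: "g (Z (4 * pi)) < g (Z (2 * pi)) +
      p (Z (2 * pi)) / (1 + \<alpha> * p' (Z (2 * pi))) * (4 * pi - 2 * pi)"
    using assms by (simp add: g_def p_def p'_def field_simps power2_eq_square)
      (smt (verit) pi_gt_zero mult_pos_pos)
  have "e \<bullet> e = 1"
    using e by (simp add: norm_eq_1)
  then have "\<not> (imaml_objective \<alpha> f ((4 * pi) *\<^sub>R e) \<ge> imaml_objective \<alpha> f ((2 * pi) *\<^sub>R e) +
      grad (imaml_objective \<alpha> f) ((2 * pi) *\<^sub>R e) \<bullet> ((4 * pi) *\<^sub>R e - (2 * pi) *\<^sub>R e))"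
    using violated by (simp add: obj grad_ridge[OF deriv] mult.commute not_le flip: scaleR_diff_left)
  moreover have "imaml_objective \<alpha> f differentiable (at x)" for x
    unfolding obj by (rule differentiable_ridge[OF deriv])
  ultimately have "nonconvex_diff (imaml_objective \<alpha> f)"
    unfolding nonconvex_diff_def by blast
  moreover have "convex_diff f" "lipschitz_gradient f" "lipschitz_hessian f"
    unfolding f_def using convex_diff_ridge[OF g p nonneg] lipschitz_gradient_ridge[OF g lip_p e]
      lipschitz_hessian_ridge[OF g p lip_p' e] by auto
  ultimately show ?thesis
    using inner by blast
qed

end
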